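(* Let $K\subseteq\mathbb{R}^d$ be a convex body, and let $\mathcal F=\{\lambda_1K,\lambda_2K,\dots\}$ with all $\lambda_i>0$ be a family of its homothets such that the set $\{\lambda_1,\lambda_2,\dots\}$ is unbounded. Then $\mathcal F$ permits a translative covering of $\mathbb{R}^d$ in which every point is covered at most $4d$ times. Moreover, if $K$ is smooth at every point where $K$ meets a supporting hyperplane of $K$ that is parallel to one of the $d$ coordinate hyperplanes, then $\mathcal F$ permits a translative covering of $\mathbb{R}^d$ in which every point is covered at most $2d$ times.
   Context: A convex body is a compact convex subset of $\mathbb{R}^d$ with nonempty interior. $\mathcal F$ permits a translative covering of $A$ if one can select a translation vector $x_F$ for each member $F\in\mathcal F$ such that $A\subseteq\bigcup_{F\in\mathcal F}(x_F+F)$. $K$ is smooth at a boundary point if it has a unique supporting hyperplane there. *)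

theory Defs
  imports "HOL-Analysis.Analysis"
begin

definition convex_body :: "'a::euclidean_space set \<Rightarrow> bool" where
  "convex_body K \<longleftrightarrow> compact K \<and> convex K \<and> interior K \<noteq> {}"

definition supporting_hyperplane :: "'a::euclidean_space set \<Rightarrow> 'a set \<Rightarrow> bool" where
  "supporting_hyperplane K H \<longleftrightarrow>
     (\<exists>a c. a \<noteq> 0 \<and> H = {y. a \<bullet> y = c} \<and> (\<forall>y\<in>K. a \<bullet> y \<le> c) \<and> H \<inter> K \<noteq> {})"

definition smooth_at :: "'a::euclidean_space set \<Rightarrow> 'a \<Rightarrow> bool" where
  "smooth_at K p \<longleftrightarrow> p \<in> frontier K \<and> (\<exists>!H. supporting_hyperplane K H \<and> p \<in> H)"

definition translative_covering_mult ::
  "(nat \<Rightarrow> 'a::euclidean_space set) \<Rightarrow> 'a set \<Rightarrow> nat \<Rightarrow> bool" where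
  "translative_covering_mult F A m \<longleftrightarrow>
     (\<exists>x :: nat \<Rightarrow> 'a.
        A \<subseteq> (\<Union>i. (\<lambda>y. x i + y) ` F i) \<and>
        (\<forall>p. finite {i. p \<in> (\<lambda>y. x i + y) ` F i} \<and>
             card {i. p \<in> (\<lambda>y. x i + y) ` F i} \<le> m))"

end

theory Submission
  imports Defs
begin

text \<open>Call \<open>u\<close> flat if large homothets of \<open>K\<close> look like the half-space \<open>{x. u \<bullet> x \<ge> 0}\<close> near a suitable
  frontier point.  Pick finitely many flat directions that positively span the space, so that the
  polytopes \<open>{x. \<forall>j. u j \<bullet> x \<le> h j}\<close> are bounded.  Cycling through the directions, push
  one facet at a time outwards: a huge homothet starting just below the facet covers the added
  slice, which is chosen so thick that the next homothet in this direction starts beyond everything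
  placed before the current one.  Hence only bodies from about one round of the cycle can
  meet, and among these, bodies in opposite directions are disjoint.

  In general, \<open>2 * DIM('a) + 1\<close> flat directions are obtained from points at which \<open>K\<close> is touched by a
  ball from inside; under the smoothness assumption the \<open>2 * DIM('a)\<close> axis directions are flat.\<close>

subsection \<open>Flat directions\<close>

text \<open>With \<open>s = 1 / \<lambda>\<close> this says: every sufficiently large homothet of
  \<open>K\<close>, moved so that the image of \<open>p\<close> is the origin, contains all points
  of norm at most \<open>R\<close> at height at least 1 in direction \<open>u\<close>. The gap
  between heights 0 and 1 leaves room for the curvature of \<open>K\<close> at
  \<open>p\<close>.\<close>

definition flat_direction :: "'a::euclidean_space set \<Rightarrow> 'a \<Rightarrow> bool" where
  "flat_direction K u \<longleftrightarrow> u \<noteq> 0 \<and> (\<exists>p. (\<forall>y\<in>K. u \<bullet> p \<le> u \<bullet> y) \<and>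
     (\<forall>R. \<exists>r>0. \<forall>s x. 0 < s \<and> s \<le> r \<and> norm x \<le> R \<and> 1 \<le> u \<bullet> x \<longrightarrow> p + s *\<^sub>R x \<in> K))"

lemma norm_diff_scaleR_sq:
  "(norm (y - s *\<^sub>R x))\<^sup>2 = (norm y)\<^sup>2 - 2 * s * (x \<bullet> y) + s\<^sup>2 * (x \<bullet> x)"
  unfolding power2_norm_eq_inner inner_diff_left inner_diff_right
  by (simp add: inner_commute[of y x] power2_eq_square)

lemma flat_direction_if_inner_ball:
  fixes u p :: "'a::euclidean_space"
  assumes "norm u = 1" "\<rho> > 0" "cball (p + \<rho> *\<^sub>R u) \<rho> \<subseteq> K" "\<forall>y\<in>K. u \<bullet> p \<le> u \<bullet> y"
  shows "flat_direction K u"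
  unfolding flat_direction_def
proof (intro conjI exI[of _ p] allI)
  show "u \<noteq> 0" using assms(1) by auto
  show "\<forall>y\<in>K. u \<bullet> p \<le> u \<bullet> y" by fact
  fix R :: real
  have pos: "R\<^sup>2 + 1 > 0" by (simp add: add_nonneg_pos)
  show "\<exists>r>0. \<forall>s x. 0 < s \<and> s \<le> r \<and> norm x \<le> R \<and> 1 \<le> u \<bullet> x \<longrightarrow> p + s *\<^sub>R x \<in> K"
  \<comment> \<open>For \<open>s > 0\<close>, the point \<open>p + s *\<^sub>R x\<close> lies in the
    ball exactly if \<open>s * (x \<bullet> x) \<le> 2 * \<rho> * (u \<bullet> x)\<close>. The added
    1 keeps the denominator positive for \<open>R = 0\<close>.\<close>
  proof (intro exI[of _ "2 * \<rho> / (R\<^sup>2 + 1)"] conjI allI impI)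
    show "0 < 2 * \<rho> / (R\<^sup>2 + 1)" using assms(2) pos by simp
    fix s and x :: 'a
    assume h: "0 < s \<and> s \<le> 2 * \<rho> / (R\<^sup>2 + 1) \<and> norm x \<le> R \<and> 1 \<le> u \<bullet> x"
    have "s * (x \<bullet> x) \<le> s * (R\<^sup>2 + 1)"
    proof (rule mult_left_mono)
      have "(norm x)\<^sup>2 \<le> R\<^sup>2" using h by (intro power_mono) auto
      then show "x \<bullet> x \<le> R\<^sup>2 + 1" by (simp add: dot_square_norm)
    qed (use h in simp)
    also have "\<dots> \<le> 2 * \<rho>" using h pos by (simp add: pos_le_divide_eq)
    also have "\<dots> \<le> 2 * \<rho> * (u \<bullet> x)" using h assms(2) by simp
    finally have le: "s * (s * (x \<bullet> x)) \<le> s * (2 * \<rho> * (u \<bullet> x))"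
      using h by (intro mult_left_mono) auto
    have "(norm (\<rho> *\<^sub>R u - s *\<^sub>R x))\<^sup>2 = \<rho>\<^sup>2 - 2 * s * (\<rho> * (u \<bullet> x)) + s\<^sup>2 * (x \<bullet> x)"
      unfolding norm_diff_scaleR_sq using assms(1) by (simp add: inner_commute power_mult_distrib)
    also have "\<dots> \<le> \<rho>\<^sup>2" using le by (simp add: power2_eq_square mult.assoc mult.left_commute)
    finally have "(norm (\<rho> *\<^sub>R u - s *\<^sub>R x))\<^sup>2 \<le> \<rho>\<^sup>2" .
    then have "norm (\<rho> *\<^sub>R u - s *\<^sub>R x) \<le> \<rho>"
      by (rule power2_le_imp_le) (use assms(2) in simp)
    then have "p + s *\<^sub>R x \<in> cball (p + \<rho> *\<^sub>R u) \<rho>" by (simp add: dist_norm)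
    then show "p + s *\<^sub>R x \<in> K" using assms(3) by blast
  qed
qed

text \<open>The limit \<open>t \<rightarrow> 0\<close>: it carries a bound along an open ray to the
  origin of the ray in the separation arguments below.\<close>

lemma le_if_le_add_small_mult:
  fixes a b c :: real
  assumes "\<And>t. t > 0 \<Longrightarrow> c \<le> a + t * b"
  shows "c \<le> a"
proof (rule field_le_epsilon)
  fix e :: real assume "e > 0"
  have "e / (\<bar>b\<bar> + 1) * b \<le> e / (\<bar>b\<bar> + 1) * (\<bar>b\<bar> + 1)"
    using \<open>e > 0\<close> by (intro mult_left_mono) auto
  also have "\<dots> = e" by (simp add: add_nonneg_eq_0_iff)
  finally show "c \<le> a + e"
    using assms[of "e / (\<bar>b\<bar> + 1)"] \<open>e > 0\<close> by (simp add: add_nonneg_pos)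
qed

lemma ex_supporting_normal:
  fixes K :: "'a::euclidean_space set"
  assumes "convex K" "p \<in> closure K" "p \<notin> interior K" "interior K \<noteq> {}"
  obtains a where "a \<noteq> 0" "\<forall>y\<in>K. a \<bullet> p \<le> a \<bullet> y"
  using supporting_hyperplane_relative_frontier[OF assms(1,2)] assms(3,4)
    rel_interior_nonempty_interior[OF assms(4)] closure_subset by (metis subsetD)

text \<open>Slide a small ball, starting inside \<open>K\<close>, in direction \<open>- v\<close> until it touches the frontier
  of \<open>K\<close>.  A larger concentric ball fitted at the start, so the hyperplane at the touching
  point cannot be parallel to \<open>v\<close> or face the other way.\<close>

lemma ex_flat_direction:
  fixes K :: "'a::euclidean_space set"
  assumes K: "convex_body K" and "v \<noteq> 0"
  shows "\<exists>u. flat_direction K u \<and> u \<bullet> v > 0"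
proof -
  have cK: "compact K" and conv: "convex K" and int: "interior K \<noteq> {}"
    using K by (auto simp: convex_body_def)
  obtain c r where r: "r > 0" "cball c r \<subseteq> K"
    using int by (metis all_not_in_conv mem_interior_cball)
  define \<rho> where "\<rho> = r / 2"
  have \<rho>: "\<rho> > 0" "\<rho> < r" using r by (auto simp: \<rho>_def)
  define W where "W = {t. 0 \<le> t \<and> cball (c - t *\<^sub>R v) \<rho> \<subseteq> K}"
  have W_alt: "W = {0..} \<inter> (\<Inter>y\<in>cball 0 \<rho>. (\<lambda>t. c - t *\<^sub>R v + y) -` K)"
  proof -
    have "cball x \<rho> \<subseteq> K \<longleftrightarrow> (\<forall>y\<in>cball 0 \<rho>. x + y \<in> K)" for x
      by (metis add.right_neutral cball_translation image_subset_iff)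
    then show ?thesis unfolding W_def by auto
  qed
  have "closed W"
    unfolding W_alt using compact_imp_closed[OF cK]
    by (intro closed_Int closed_atLeast closed_INT ballI closed_vimage) (auto intro!: continuous_intros)
  moreover have "bounded W"
  proof -
    obtain D where D: "\<And>x. x \<in> K \<Longrightarrow> norm x \<le> D"
      using compact_imp_bounded[OF cK] by (auto simp: bounded_iff)
    have "norm t \<le> (D + norm c) / norm v" if "t \<in> W" for t
    proof -
      have "norm (c - t *\<^sub>R v) \<le> D" using that \<rho> by (intro D) (auto simp: W_def)
      moreover have "norm (t *\<^sub>R v) \<le> norm (c - t *\<^sub>R v) + norm c"
        using norm_triangle_ineq4[of c "c - t *\<^sub>R v"] by simp
      ultimately have "\<bar>t\<bar> * norm v \<le> D + norm c" by simp
      then show ?thesis using \<open>v \<noteq> 0\<close> by (simp add: pos_le_divide_eq)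
    qed
    then show ?thesis by (auto simp: bounded_iff)
  qed
  ultimately have "compact W" by (simp add: compact_eq_bounded_closed)
  moreover have "0 \<in> W"
    using r \<rho> by (auto simp: W_def)
  ultimately obtain t where t: "t \<in> W" and tmax: "\<And>s. s \<in> W \<Longrightarrow> s \<le> t"
    using compact_attains_sup[of W] by auto
  define x where "x = c - t *\<^sub>R v"
  have t0: "t \<ge> 0" and xK: "cball x \<rho> \<subseteq> K" using t by (auto simp: W_def x_def)
  have "\<not> cball x \<rho> \<subseteq> interior K"
  proof
    assume "cball x \<rho> \<subseteq> interior K"
    then obtain e where e: "e > 0" "(\<Union>y\<in>cball x \<rho>. ball y e) \<subseteq> interior K"
      using compact_subset_open_imp_ball_epsilon_subset[OF compact_cball open_interior] by metis
    \<comment> \<open>Sliding from \<open>t\<close> to \<open>s\<close> moves every point by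
      \<open>e / 2\<close>, so the ball stays in \<open>K\<close>, against the maximality of
      \<open>t\<close>.\<close>
    define s where "s = t + e / (2 * norm v)"
    have "cball (c - s *\<^sub>R v) \<rho> \<subseteq> K"
    proof
      fix y assume "y \<in> cball (c - s *\<^sub>R v) \<rho>"
      define z where "z = y + (s - t) *\<^sub>R v"
      have "z \<in> cball x \<rho>"
        using \<open>y \<in> _\<close> by (simp add: z_def x_def dist_norm algebra_simps)
      moreover have "dist z y < e"
        using e \<open>v \<noteq> 0\<close> by (simp add: z_def s_def dist_norm)
      ultimately show "y \<in> K" using e interior_subset by (fastforce simp: subset_eq)
    qed
    moreover have "s > t" using e \<open>v \<noteq> 0\<close> by (simp add: s_def)
    ultimately have "s \<in> W" using t0 by (simp add: W_def)
    then show False using tmax[of s] \<open>s > t\<close> by simp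
  qed
  then obtain p where p: "p \<in> cball x \<rho>" "p \<notin> interior K" by blast
  then have "p \<in> closure K" using xK closure_subset by blast
  then obtain a where a: "a \<noteq> 0" "\<forall>y\<in>K. a \<bullet> p \<le> a \<bullet> y"
    using ex_supporting_normal[OF conv _ p(2) int] by blast
  define u where "u = a /\<^sub>R norm a"
  have nu: "norm u = 1" using a by (simp add: u_def)
  then have uu: "u \<bullet> u = 1" by (simp add: dot_square_norm)
  have up: "u \<bullet> p \<le> u \<bullet> y" if "y \<in> K" for y
    using a that by (simp add: u_def divide_right_mono field_simps)
  \<comment> \<open>The lowest point of the ball in direction \<open>u\<close> is no lower than
    \<open>p\<close>, while \<open>p\<close> is within \<open>\<rho>\<close> of the centre. This is
    the equality case of Cauchy-Schwarz and forces
    \<open>x - p = \<rho> *\<^sub>R u\<close>.\<close>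
  have "u \<bullet> p \<le> u \<bullet> (x - \<rho> *\<^sub>R u)"
    using \<rho> nu by (intro up set_mp[OF xK]) (auto simp: dist_norm)
  then have ge: "u \<bullet> (x - p) \<ge> \<rho>" by (simp add: inner_diff_right uu)
  have px: "p + \<rho> *\<^sub>R u = x"
  proof -
    have "(norm (x - p))\<^sup>2 \<le> \<rho>\<^sup>2"
      using p(1) by (intro power_mono) (auto simp: dist_norm)
    moreover have "\<rho> * \<rho> \<le> \<rho> * (u \<bullet> (x - p))" using ge \<rho> by simp
    moreover have "(norm (x - p - \<rho> *\<^sub>R u))\<^sup>2 = (norm (x - p))\<^sup>2 - 2 * \<rho> * (u \<bullet> (x - p)) + \<rho>\<^sup>2"
      unfolding norm_diff_scaleR_sq by (simp add: uu)
    ultimately have "(norm (x - p - \<rho> *\<^sub>R u))\<^sup>2 \<le> 0" by (simp add: power2_eq_square)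
    then show ?thesis by (simp add: algebra_simps)
  qed
  \<comment> \<open>The lowest point of the larger ball around \<open>c\<close> is no lower than
    \<open>p\<close> either; comparing it with the height of \<open>p\<close> computed from the
    small ball leaves the gap \<open>r - \<rho> > 0\<close>.\<close>
  have "u \<bullet> p \<le> u \<bullet> (c - r *\<^sub>R u)"
    using r nu by (intro up set_mp[OF r(2)]) (auto simp: dist_norm)
  moreover have "u \<bullet> p = u \<bullet> c - t * (u \<bullet> v) - \<rho>"
    using px by (metis x_def add_diff_cancel_right' inner_diff_right inner_scaleR_right mult.right_neutral uu)
  ultimately have "t * (u \<bullet> v) \<ge> r - \<rho>" by (simp add: inner_diff_right uu)
  then have "t * (u \<bullet> v) > 0" using \<rho> by simp
  then have "u \<bullet> v > 0" using t0 by (simp add: zero_less_mult_iff)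
  moreover have "flat_direction K u"
    using flat_direction_if_inner_ball[OF nu \<rho>(1), of p K] px xK up by simp
  ultimately show ?thesis by blast
qed

text \<open>The tangent cone at a smooth point contains the open half-space: otherwise a ray leaving
  \<open>K\<close> could be separated from \<open>K\<close> by a second supporting hyperplane.\<close>

lemma smooth_point_ray_enters:
  fixes K :: "'a::euclidean_space set"
  assumes K: "convex_body K" and sm: "smooth_at K p" and "p \<in> K" "u \<noteq> 0"
    and supp: "\<forall>y\<in>K. u \<bullet> p \<le> u \<bullet> y" and "u \<bullet> v > 0"
  shows "\<exists>t>0. p + t *\<^sub>R v \<in> K"
proof (rule ccontr)
  assume "\<not> ?thesis"
  then have disj: "K \<inter> (\<lambda>t. p + t *\<^sub>R v) ` {0<..} = {}" by auto
  have conv: "convex K" and int: "interior K \<noteq> {}"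
    using K by (auto simp: convex_body_def)
  have ray_convex: "convex ((\<lambda>t. p + t *\<^sub>R v) ` {0<..})"
  proof -
    have "(\<lambda>t. p + t *\<^sub>R v) ` {0<..} = (+) p ` (\<lambda>t. t *\<^sub>R v) ` {0<..}" by auto
    then show ?thesis
      by (simp add: convex_translation convex_linear_image linear_scale_self
          bounded_linear.linear[OF bounded_linear_scaleR_left])
  qed
  have "K \<noteq> {}" "(\<lambda>t. p + t *\<^sub>R v) ` {0<..} \<noteq> {}"
    using \<open>p \<in> K\<close> by auto
  from separating_hyperplane_sets[OF conv ray_convex this disj]
  obtain a b where a: "a \<noteq> 0" "\<forall>y\<in>K. a \<bullet> y \<le> b" "\<forall>y\<in>(\<lambda>t. p + t *\<^sub>R v) ` {0<..}. b \<le> a \<bullet> y"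
    by metis
  have ray: "b \<le> a \<bullet> p + t * (a \<bullet> v)" if "t > 0" for t
    using a(3) that by (force simp: inner_add_right)
  have "b \<le> a \<bullet> p" using ray by (rule le_if_le_add_small_mult)
  then have b: "b = a \<bullet> p" using a(2) \<open>p \<in> K\<close> by force
  have av: "a \<bullet> v \<ge> 0" using ray[of 1] b by simp
  have "supporting_hyperplane K {y. a \<bullet> y = b}"
    unfolding supporting_hyperplane_def
    using a b \<open>p \<in> K\<close> by (intro exI[of _ a] exI[of _ b]) auto
  moreover have "supporting_hyperplane K {y. u \<bullet> y = u \<bullet> p}"
    unfolding supporting_hyperplane_def
    using supp \<open>u \<noteq> 0\<close> \<open>p \<in> K\<close> by (intro exI[of _ "-u"] exI[of _ "- (u \<bullet> p)"]) auto
  moreover have "p \<in> {y. a \<bullet> y = b}" "p \<in> {y. u \<bullet> y = u \<bullet> p}" using b by auto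
  ultimately have eq: "{y. a \<bullet> y = b} = {y. u \<bullet> y = u \<bullet> p}"
    using sm unfolding smooth_at_def by metis
  \<comment> \<open>Smoothness made the two hyperplanes coincide, so \<open>a\<close> is
    \<open>k\<close> times \<open>u\<close>. The ray gives \<open>k > 0\<close>, which puts
    \<open>K\<close> on both sides of the same hyperplane, hence inside it; this contradicts the
    nonempty interior.\<close>
  define k where "k = (a \<bullet> u) / (u \<bullet> u)"
  have uu: "u \<bullet> u > 0" using \<open>u \<noteq> 0\<close> by simp
  have orth: "a \<bullet> z = 0" if "u \<bullet> z = 0" for z
  proof -
    have "p + z \<in> {y. u \<bullet> y = u \<bullet> p}" using that by (simp add: inner_add_right)
    then have "p + z \<in> {y. a \<bullet> y = b}" using eq by simp
    then show ?thesis using b by (simp add: inner_add_right)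
  qed
  have ak: "a \<bullet> z = k * (u \<bullet> z)" for z
  proof -
    have "a \<bullet> (z - ((u \<bullet> z) / (u \<bullet> u)) *\<^sub>R u) = 0"
      using uu by (intro orth) (simp add: inner_diff_right)
    then show ?thesis by (simp add: inner_diff_right k_def field_simps)
  qed
  have "k \<noteq> 0" using ak[of a] a(1) by auto
  obtain q e where "e > 0" "cball q e \<subseteq> K"
    using int by (metis all_not_in_conv mem_interior_cball)
  have k: "k \<ge> 0" using av ak[of v] \<open>u \<bullet> v > 0\<close> by (simp add: zero_le_mult_iff)
  have const: "u \<bullet> y = u \<bullet> p" if "y \<in> K" for y
  proof -
    have "k * (u \<bullet> y) \<le> k * (u \<bullet> p)" using a(2) b ak that by metis
    then show ?thesis using k \<open>k \<noteq> 0\<close> supp that by (simp add: antisym)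
  qed
  have "q + (e / norm u) *\<^sub>R u \<in> K" "q \<in> K"
    using \<open>e > 0\<close> \<open>u \<noteq> 0\<close> by (auto intro!: set_mp[OF \<open>cball q e \<subseteq> K\<close>] simp: dist_norm)
  then have "u \<bullet> (q + (e / norm u) *\<^sub>R u) = u \<bullet> q" using const by metis
  then show False using uu \<open>e > 0\<close> \<open>u \<noteq> 0\<close> by (simp add: inner_add_right)
qed

text \<open>A compactness argument: every point of the compact cap \<open>C\<close> is carried into
  the interior of \<open>K\<close> by some scale \<open>inverse (real (Suc n))\<close>, an open
  condition, so finitely many scales serve all of \<open>C\<close>. By convexity a scale that works
  may be decreased, so one bound serves all.\<close>

lemma flat_direction_if_smooth:
  fixes K :: "'a::euclidean_space set"
  assumes K: "convex_body K" and sm: "smooth_at K p" and "p \<in> K" "u \<noteq> 0"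
    and supp: "\<forall>y\<in>K. u \<bullet> p \<le> u \<bullet> y"
  shows "flat_direction K u"
  unfolding flat_direction_def
proof (intro conjI exI[of _ p] allI)
  show "u \<noteq> 0" "\<forall>y\<in>K. u \<bullet> p \<le> u \<bullet> y" by fact+
  fix R :: real
  have conv: "convex K" using K by (auto simp: convex_body_def)
  obtain q where q: "q \<in> interior K"
    using K by (auto simp: convex_body_def)
  define C where "C = {x. norm x \<le> R \<and> 1 \<le> u \<bullet> x}"
  have "C = cball 0 R \<inter> {x. u \<bullet> x \<ge> 1}" by (auto simp: C_def)
  then have "compact C" by (simp add: compact_Int_closed closed_halfspace_ge)
  define O' where "O' n = (\<lambda>x. p + inverse (real (Suc n)) *\<^sub>R x) -` interior K" for n
  have op: "open (O' n)" for n
    unfolding O'_def by (intro open_vimage) (auto intro!: continuous_intros)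
  have shrink: "p + s *\<^sub>R x \<in> interior K" if "p + t *\<^sub>R x \<in> interior K" "0 < s" "s \<le> t" for s t x
  proof -
    have "p - (s / t) *\<^sub>R (p - (p + t *\<^sub>R x)) \<in> interior K"
      using that by (intro mem_interior_convex_shrink[OF conv]) (auto simp: \<open>p \<in> K\<close>)
    then show ?thesis using that by simp
  qed
  have "C \<subseteq> (\<Union>n. O' n)"
  proof
    fix x assume "x \<in> C"
    define w where "w = q - p"
    \<comment> \<open>Tilting \<open>x\<close> slightly away from the interior point
      \<open>q\<close> keeps its height positive, since the height is at least 1 and changes by at
      most 1/2. The tilted ray enters \<open>K\<close>, and moving back towards \<open>q\<close>
      reaches the interior.\<close>
    define d where "d = 1 / (2 * (\<bar>u \<bullet> w\<bar> + 1))"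
    have d: "d > 0" by (simp add: d_def)
    have "d * (u \<bullet> w) \<le> d * (\<bar>u \<bullet> w\<bar> + 1)" using d by (intro mult_left_mono) auto
    also have "\<dots> = 1/2" unfolding d_def by (simp add: field_simps)
    finally have "u \<bullet> (x - d *\<^sub>R w) > 0"
      using \<open>x \<in> C\<close> by (simp add: inner_diff_right C_def)
    then obtain t where t: "t > 0" "p + t *\<^sub>R (x - d *\<^sub>R w) \<in> K"
      using smooth_point_ray_enters[OF K sm \<open>p \<in> K\<close> \<open>u \<noteq> 0\<close> supp] by blast
    \<comment> \<open>The weight \<open>l\<close> solves \<open>l = (1 - l) * t * d\<close>, so the
      components along \<open>w\<close> cancel and the interior point found lies on the ray in
      direction \<open>x\<close> itself.\<close>
    define l where "l = t * d / (1 + t * d)"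
    have td: "t * d > 0" using t d by simp
    then have l1: "1 - l = 1 / (1 + t * d)" by (simp add: l_def field_simps)
    have l: "0 < l" "1 - l > 0" "l = (1 - l) * t * d"
      using td by (auto simp: l1) (auto simp: l_def)
    then have "l \<le> 1" by simp
    have "p + t *\<^sub>R (x - d *\<^sub>R w) - l *\<^sub>R (p + t *\<^sub>R (x - d *\<^sub>R w) - q) \<in> interior K"
      by (rule mem_interior_convex_shrink[OF conv q t(2) l(1) \<open>l \<le> 1\<close>])
    also have "p + t *\<^sub>R (x - d *\<^sub>R w) - l *\<^sub>R (p + t *\<^sub>R (x - d *\<^sub>R w) - q)
      = p + ((1 - l) * t) *\<^sub>R x + (l - (1 - l) * t * d) *\<^sub>R w"
      by (simp add: w_def algebra_simps)
    also have "\<dots> = p + ((1 - l) * t) *\<^sub>R x" using l(3) by simp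
    finally have in_int: "p + ((1 - l) * t) *\<^sub>R x \<in> interior K" .
    obtain n where "inverse (real (Suc n)) < (1 - l) * t"
      using reals_Archimedean[of "(1 - l) * t"] l t by auto
    then have "x \<in> O' n" using shrink[OF in_int] by (simp add: O'_def)
    then show "x \<in> (\<Union>n. O' n)" by blast
  qed
  then obtain D where D: "finite D" "C \<subseteq> (\<Union>n\<in>D. O' n)"
    using compactE_image[OF \<open>compact C\<close>, of UNIV O'] op by auto
  obtain N where N: "\<forall>n\<in>D. n \<le> N" using D(1) finite_nat_set_iff_bounded_le by blast
  show "\<exists>r>0. \<forall>s x. 0 < s \<and> s \<le> r \<and> norm x \<le> R \<and> 1 \<le> u \<bullet> x \<longrightarrow> p + s *\<^sub>R x \<in> K"
  proof (intro exI[of _ "inverse (real (Suc N))"] conjI allI impI)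
    fix s x assume h: "0 < s \<and> s \<le> inverse (real (Suc N)) \<and> norm x \<le> R \<and> 1 \<le> u \<bullet> x"
    then have "x \<in> C" by (simp add: C_def)
    then obtain n where n: "n \<in> D" "x \<in> O' n" using D by blast
    have "inverse (real (Suc N)) \<le> inverse (real (Suc n))"
      using N n(1) by (intro le_imp_inverse_le) auto
    then have "s \<le> inverse (real (Suc n))" using h by linarith
    moreover have "p + inverse (real (Suc n)) *\<^sub>R x \<in> interior K"
      using n(2) unfolding O'_def by (rule vimageD)
    ultimately have "p + s *\<^sub>R x \<in> interior K"
      using shrink h by blast
    then show "p + s *\<^sub>R x \<in> K" using interior_subset by blast
  qed simp
qed

subsection \<open>Positively spanning sets\<close>

text \<open>A basis \<open>B\<close> together with a small set whose convex hull meets the ray spanned by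
  \<open>- \<Sum>B\<close>.\<close>

lemma few_positively_spanning:
  fixes N :: "'a::euclidean_space set"
  assumes N: "\<And>v. v \<noteq> 0 \<Longrightarrow> \<exists>u\<in>N. u \<bullet> v > 0"
  shows "\<exists>U. finite U \<and> U \<subseteq> N \<and> card U \<le> 2 * DIM('a) + 1 \<and> (\<forall>v. v \<noteq> 0 \<longrightarrow> (\<exists>u\<in>U. u \<bullet> v > 0))"
proof -
  obtain B where B: "B \<subseteq> N" "independent B" "N \<subseteq> span B"
    using maximal_independent_subset[of N] by blast
  have finB: "finite B" and cardB: "card B \<le> DIM('a)"
    using independent_bound[OF B(2)] by auto
  define w where "w = \<Sum>B"
  define S where "S = (\<Union>x\<in>convex hull N. \<Union>y\<in>(\<lambda>t. t *\<^sub>R w) ` {0<..}. {x + y})"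
  have "convex ((\<lambda>t. t *\<^sub>R w) ` {0::real<..})"
    by (simp add: convex_linear_image bounded_linear.linear[OF bounded_linear_scaleR_left])
  then have "convex S" unfolding S_def by (intro convex_sums) auto
  \<comment> \<open>This says that the hull of \<open>N\<close> contains
    \<open>- t *\<^sub>R w\<close> for some \<open>t > 0\<close>. Otherwise a separating normal
    \<open>a\<close> has nonnegative inner product with all of \<open>N\<close>, against the
    hypothesis for \<open>- a\<close>.\<close>
  have "0 \<in> S"
  proof (rule ccontr)
    assume "0 \<notin> S"
    then obtain a where a: "a \<noteq> 0" "\<forall>x\<in>S. 0 \<le> a \<bullet> x"
      using separating_hyperplane_set_0[OF \<open>convex S\<close>] by blast
    then obtain u where u: "u \<in> N" "u \<bullet> (- a) > 0" using N[of "- a"] by auto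
    have ge: "0 \<le> a \<bullet> u + t * (a \<bullet> w)" if "t > 0" for t
    proof -
      have "u + t *\<^sub>R w \<in> S" using that u hull_inc[of u N] by (auto simp: S_def)
      then show ?thesis using a by (force simp: inner_add_right)
    qed
    have "0 \<le> a \<bullet> u" using ge by (rule le_if_le_add_small_mult)
    then show False using u(2) by (simp add: inner_commute)
  qed
  then obtain x t where x: "x \<in> convex hull N" "t > 0" "x + t *\<^sub>R w = 0" by (auto simp: S_def)
  then obtain C where C: "finite C" "C \<subseteq> N" "card C \<le> DIM('a) + 1" "x \<in> convex hull C"
    unfolding caratheodory[of N] by blast
  show ?thesis
  proof (intro exI[of _ "B \<union> C"] conjI allI impI)
    show "finite (B \<union> C)" "B \<union> C \<subseteq> N" using B C finB by auto
    show "card (B \<union> C) \<le> 2 * DIM('a) + 1" using card_Un_le[of B C] cardB C(3) by linarith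
    fix v :: 'a assume "v \<noteq> 0"
    show "\<exists>u\<in>B \<union> C. u \<bullet> v > 0"
    proof (rule ccontr)
      assume "\<not> ?thesis"
      \<comment> \<open>On \<open>C\<close> the inequality gives
        \<open>v \<bullet> x \<le> 0\<close>, hence \<open>v \<bullet> w \<ge> 0\<close>; but
        \<open>v \<bullet> w\<close> is a sum of nonpositive terms over \<open>B\<close>. So
        \<open>v\<close> is orthogonal to \<open>B\<close>, and therefore to
        \<open>N\<close>.\<close>
      then have le: "u \<bullet> v \<le> 0" if "u \<in> B \<union> C" for u using that by force
      have "convex hull C \<subseteq> {y. v \<bullet> y \<le> 0}"
        using le by (intro hull_minimal convex_halfspace_le) (auto simp: inner_commute)
      then have "v \<bullet> x \<le> 0" using C(4) by auto
      moreover have "x = - (t *\<^sub>R w)" using x(3) by (simp add: add_eq_0_iff2)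
      ultimately have "t * (v \<bullet> w) \<ge> 0" by simp
      then have "v \<bullet> w \<ge> 0" using x(2) by (simp add: zero_le_mult_iff)
      moreover have "v \<bullet> w = - (\<Sum>b\<in>B. - (b \<bullet> v))"
        by (simp add: w_def inner_sum_right sum_negf inner_commute)
      moreover have "(\<Sum>b\<in>B. - (b \<bullet> v)) \<ge> 0" using le by (intro sum_nonneg) auto
      ultimately have "(\<Sum>b\<in>B. - (b \<bullet> v)) = 0" by linarith
      then have "\<forall>b\<in>B. - (b \<bullet> v) = 0" using finB le by (subst (asm) sum_nonneg_eq_0_iff) auto
      then have "orthogonal v u" if "u \<in> N" for u
        using that B(3) by (intro orthogonal_to_span[of u B]) (auto simp: orthogonal_def inner_commute)
      then show False using N[OF \<open>v \<noteq> 0\<close>] by (force simp: orthogonal_def inner_commute)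
    qed
  qed
qed

text \<open>The sum of the positive parts of \<open>u \<bullet> x\<close> is continuous and positive
  on the unit sphere, so it has a positive minimum there. Some summand reaches the average
  \<open>c\<close>, and homogeneity does the rest.\<close>

lemma positively_spanning_norm_bound:
  fixes U :: "'a::euclidean_space set"
  assumes "finite U" and U: "\<And>v. v \<noteq> 0 \<Longrightarrow> \<exists>u\<in>U. u \<bullet> v > 0"
  shows "\<exists>c>0. \<forall>x. \<exists>u\<in>U. c * norm x \<le> u \<bullet> x"
proof -
  define f where "f x = (\<Sum>u\<in>U. max 0 (u \<bullet> x))" for x
  have "continuous_on (sphere 0 1) f"
    unfolding f_def by (intro continuous_intros)
  moreover obtain e :: 'a where e: "norm e = 1" using vector_choose_size[of 1] by auto
  ultimately obtain z where z: "norm z = 1" "\<And>x. norm x = 1 \<Longrightarrow> f z \<le> f x"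
    using continuous_attains_inf[of "sphere 0 1" f] by auto
  obtain w where "w \<in> U" "w \<bullet> z > 0" using U[of z] z(1) by fastforce
  then have fz: "f z > 0"
    unfolding f_def using \<open>finite U\<close> by (intro sum_pos2[of U w]) auto
  have cU: "card U > 0" using \<open>finite U\<close> \<open>w \<in> U\<close> by (auto simp: card_gt_0_iff)
  define c where "c = f z / card U"
  have c: "c > 0" using fz cU by (simp add: c_def)
  have unit: "\<exists>u\<in>U. c \<le> u \<bullet> x" if "norm x = 1" for x
  proof (rule ccontr)
    assume "\<not> ?thesis"
    then have "f x < (\<Sum>u\<in>U. c)"
      unfolding f_def using c \<open>finite U\<close> \<open>w \<in> U\<close> by (intro sum_strict_mono) (auto simp: not_le)
    also have "\<dots> = f z" using cU by (simp add: c_def)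
    finally show False using z(2)[OF that] by simp
  qed
  have "\<exists>u\<in>U. c * norm x \<le> u \<bullet> x" for x
  proof (cases "x = 0")
    case False
    then obtain u where "u \<in> U" "c \<le> u \<bullet> (x /\<^sub>R norm x)" using unit[of "x /\<^sub>R norm x"] by auto
    then show ?thesis using False by (auto simp: field_simps)
  qed (use \<open>w \<in> U\<close> in auto)
  then show ?thesis using c by blast
qed

subsection \<open>Placing the bodies\<close>

text \<open>The nested images copy the form of a translate in
  \<open>translative_covering_mult\<close>, so that folding this definition turns the goal into one
  about \<open>homothet\<close>.\<close>

definition homothet :: "'a::euclidean_space set \<Rightarrow> (nat \<Rightarrow> real) \<Rightarrow> nat \<Rightarrow> 'a \<Rightarrow> 'a set" where
  "homothet K lam i t = (\<lambda>y. t + y) ` (\<lambda>y. lam i *\<^sub>R y) ` K"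

lemma translative_covering_mult_mono:
  "translative_covering_mult F A m \<Longrightarrow> m \<le> n \<Longrightarrow> translative_covering_mult F A n"
  unfolding translative_covering_mult_def by (meson le_trans)

lemma bounded_homothet: "bounded K \<Longrightarrow> bounded (homothet K lam i t)"
  unfolding homothet_def by (intro bounded_translation bounded_scaling)

lemma bounded_inner_less:
  assumes "bounded A"
  shows "\<exists>b. \<forall>y\<in>A. u \<bullet> y < (b::real)"
proof -
  obtain D where D: "\<And>y. y \<in> A \<Longrightarrow> norm y \<le> D"
    using assms by (auto simp: bounded_iff)
  have "u \<bullet> y < norm u * D + 1" if "y \<in> A" for y
  proof -
    have "u \<bullet> y \<le> norm u * norm y" by (rule norm_cauchy_schwarz)
    also have "\<dots> \<le> norm u * D" using D[OF that] by (intro mult_left_mono) auto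
    finally show ?thesis by simp
  qed
  then show ?thesis by blast
qed

lemma ex_large_index:
  fixes lam :: "nat \<Rightarrow> real"
  assumes "\<not> bdd_above (range lam)" "finite F"
  shows "\<exists>i. i \<notin> F \<and> lam i \<ge> b"
proof (rule ccontr)
  assume no: "\<not> ?thesis"
  have "range lam \<subseteq> lam ` F \<union> {..b}"
    using no by (force simp: not_le)
  moreover have "bdd_above (lam ` F \<union> {..b})" using assms(2) by simp
  ultimately show False using assms(1) bdd_above_mono by metis
qed

lemma ex_far_translate:
  assumes "bounded K" "bounded A" "u \<noteq> 0"
  shows "\<exists>t. homothet K lam i t \<inter> A = {} \<and> (\<forall>y\<in>homothet K lam i t. u \<bullet> y > b)"
proof -
  obtain e where e: "\<And>y. y \<in> A \<Longrightarrow> u \<bullet> y < e" using bounded_inner_less[OF assms(2)] by metis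
  have "bounded ((\<lambda>y. lam i *\<^sub>R y) ` K)" using assms(1) by (rule bounded_scaling)
  then obtain f where f: "\<And>y. y \<in> K \<Longrightarrow> (- u) \<bullet> (lam i *\<^sub>R y) < f"
    using bounded_inner_less[of _ "- u"] by (metis imageI)
  \<comment> \<open>\<open>f\<close> bounds how far the scaled body reaches backwards in direction
    \<open>u\<close>; the shift makes up for it and clears both \<open>b\<close> and the bound
    \<open>e\<close> of \<open>A\<close>.\<close>
  define t where "t = ((f + max b e) / (u \<bullet> u)) *\<^sub>R u"
  have ut: "u \<bullet> t = f + max b e" using assms(3) by (simp add: t_def)
  have gt: "u \<bullet> y > max b e" if y: "y \<in> homothet K lam i t" for y
  proof -
    obtain z where z: "z \<in> K" "y = t + lam i *\<^sub>R z" using y by (auto simp: homothet_def)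
    have "u \<bullet> y = f + max b e + u \<bullet> (lam i *\<^sub>R z)" by (simp only: z(2) inner_add_right ut)
    then show ?thesis using f[OF z(1)] unfolding inner_minus_left by linarith
  qed
  have "homothet K lam i t \<inter> A = {}" using gt e by fastforce
  moreover have "\<forall>y\<in>homothet K lam i t. u \<bullet> y > b" using gt by auto
  ultimately show ?thesis by blast
qed

text \<open>Directions are numbered so that step \<open>n\<close> can use number
  \<open>n mod m\<close>. The assumption \<open>spanning\<close> is the quantitative form of
  positive spanning that bounds the polytopes.\<close>

locale direction_cycle =
  fixes K :: "'a::euclidean_space set" and lam :: "nat \<Rightarrow> real" and u :: "nat \<Rightarrow> 'a" and m :: nat
  assumes bounded_K: "bounded K"
    and lam_pos: "\<And>i. lam i > 0"
    and lam_unbounded: "\<not> bdd_above (range lam)"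
    and m_pos: "m > 0"
    and flat: "\<And>j. j < m \<Longrightarrow> flat_direction K (u j)"
    and spanning: "\<exists>c>0. \<forall>x. \<exists>j<m. c * norm x \<le> u j \<bullet> x"
begin

definition polytope :: "(nat \<Rightarrow> real) \<Rightarrow> 'a set" where
  "polytope h = {x. \<forall>j<m. u j \<bullet> x \<le> h j}"

lemma bounded_polytope: "bounded (polytope h)"
proof -
  obtain c where c: "c > 0" "\<And>x. \<exists>j<m. c * norm x \<le> u j \<bullet> x" using spanning by blast
  have "norm x \<le> (\<Sum>j<m. \<bar>h j\<bar>) / c" if "x \<in> polytope h" for x
  proof -
    obtain j where j: "j < m" "c * norm x \<le> u j \<bullet> x" using c(2) by blast
    have "c * norm x \<le> \<bar>h j\<bar>" using j that by (fastforce simp: polytope_def)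
    also have "\<dots> \<le> (\<Sum>j<m. \<bar>h j\<bar>)" using j(1) by (intro member_le_sum) auto
    finally show ?thesis using c(1) by (simp add: pos_le_divide_eq mult.commute)
  qed
  then show ?thesis by (auto simp: bounded_iff)
qed

text \<open>The slice added to the polytope is bounded and lies more than 1 above the level
  \<open>h j - 1\<close>. Putting the touching point of a large homothet at the point
  \<open>z\<close> of that level therefore covers the slice by flatness.\<close>

lemma ex_covering_translate:
  assumes "bounded A" "finite F" "j < m"
  shows "\<exists>i t g. i \<notin> F \<and> h j + 5 \<le> g \<and> (\<forall>y\<in>A. u j \<bullet> y < g - 1) \<and>
     (\<forall>y\<in>homothet K lam i t. h j - 1 \<le> u j \<bullet> y) \<and>
     polytope (h(j := g)) \<subseteq> polytope h \<union> homothet K lam i t"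
proof -
  obtain p where u0: "u j \<noteq> 0" and p: "\<And>y. y \<in> K \<Longrightarrow> u j \<bullet> p \<le> u j \<bullet> y"
    and near: "\<And>R. \<exists>r>0. \<forall>s x. 0 < s \<and> s \<le> r \<and> norm x \<le> R \<and> 1 \<le> u j \<bullet> x \<longrightarrow> p + s *\<^sub>R x \<in> K"
    using flat[OF assms(3)] unfolding flat_direction_def by blast
  obtain b where b: "\<And>y. y \<in> A \<Longrightarrow> u j \<bullet> y < b" using bounded_inner_less[OF assms(1)] by metis
  \<comment> \<open>\<open>b + 1\<close> clears \<open>A\<close> by the margin 1 that the next body
    in this direction may reach below its level. The increment 5 later separates bodies in opposite
    directions.\<close>
  define g where "g = max (h j + 5) (b + 1)"
  obtain D where D: "\<And>x. x \<in> polytope (h(j := g)) \<Longrightarrow> norm x \<le> D"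
    using bounded_polytope unfolding bounded_iff by blast
  define z where "z = ((h j - 1) / (u j \<bullet> u j)) *\<^sub>R u j"
  have uz: "u j \<bullet> z = h j - 1" using u0 by (simp add: z_def)
  obtain r where r: "r > 0"
    "\<And>s x. 0 < s \<Longrightarrow> s \<le> r \<Longrightarrow> norm x \<le> D + norm z \<Longrightarrow> 1 \<le> u j \<bullet> x \<Longrightarrow> p + s *\<^sub>R x \<in> K"
    using near by meson
  obtain i where i: "i \<notin> F" "lam i \<ge> 1 / r" using ex_large_index[OF lam_unbounded assms(2)] by blast
  define t where "t = z - lam i *\<^sub>R p"
  have lower: "h j - 1 \<le> u j \<bullet> y" if y: "y \<in> homothet K lam i t" for y
  proof -
    obtain w where w: "w \<in> K" "y = t + lam i *\<^sub>R w" using y by (auto simp: homothet_def)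
    have "u j \<bullet> y = h j - 1 + lam i * (u j \<bullet> w - u j \<bullet> p)"
      unfolding w(2) t_def by (simp add: inner_add_right inner_diff_right uz algebra_simps)
    moreover have "lam i * (u j \<bullet> w - u j \<bullet> p) \<ge> 0" using lam_pos[of i] p[OF w(1)] by simp
    ultimately show ?thesis by linarith
  qed
  have "x \<in> homothet K lam i t" if x: "x \<in> polytope (h(j := g))" "x \<notin> polytope h" for x
  proof -
    have "u j \<bullet> x > h j" using x by (fastforce simp: polytope_def split: if_splits)
    then have "1 \<le> u j \<bullet> (x - z)" by (simp add: inner_diff_right uz)
    moreover have "norm (x - z) \<le> D + norm z"
      using norm_triangle_ineq4[of x z] D[OF x(1)] by linarith
    moreover have "1 / lam i \<le> r" using i(2) r(1) lam_pos[of i] by (simp add: field_simps)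
    ultimately have "p + (1 / lam i) *\<^sub>R (x - z) \<in> K" using lam_pos[of i] by (intro r(2)) auto
    moreover have "x = t + lam i *\<^sub>R (p + (1 / lam i) *\<^sub>R (x - z))"
      using lam_pos[of i] by (simp add: t_def scaleR_add_right)
    ultimately show ?thesis unfolding homothet_def by blast
  qed
  then have "polytope (h(j := g)) \<subseteq> polytope h \<union> homothet K lam i t" by blast
  moreover have "\<forall>y\<in>A. u j \<bullet> y < g - 1" using b by (force simp: g_def)
  ultimately show ?thesis using i(1) lower by (intro exI[of _ i] exI[of _ t] exI[of _ g]) (simp add: g_def)
qed

text \<open>Step \<open>n\<close> places a filler \<open>li n\<close>, which guarantees that every index is used, and a huge
  body \<open>bi n\<close>, which enlarges the covered polytope from level \<open>H n\<close> to level \<open>H (Suc n)\<close> in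
  direction \<open>n mod m\<close>.  The new level exceeds everything placed before \<open>bi n\<close>, so the next body
  in this direction avoids all of that.\<close>

definition placement ::
    "(nat \<Rightarrow> nat) \<Rightarrow> (nat \<Rightarrow> 'a) \<Rightarrow> (nat \<Rightarrow> nat) \<Rightarrow> (nat \<Rightarrow> 'a) \<Rightarrow> (nat \<Rightarrow> nat \<Rightarrow> real) \<Rightarrow> bool" where
  "placement bi bx li lx H \<longleftrightarrow>
     (\<forall>j. H 0 j = - 1) \<and>
     (\<forall>n. let j = n mod m;
              B = (\<lambda>n. homothet K lam (bi n) (bx n)); L = (\<lambda>n. homothet K lam (li n) (lx n));
              A = (\<Union>l<n. B l \<union> L l); F = bi ` {..<n} \<union> li ` {..<n}
          in li n \<notin> F \<and> n \<in> insert (li n) F \<and> bi n \<notin> insert (li n) F \<and>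
             L n \<inter> A = {} \<and> (\<forall>y\<in>L n. u j \<bullet> y > 2) \<and>
             (\<forall>y\<in>A \<union> L n. u j \<bullet> y < H (Suc n) j - 1) \<and>
             (\<forall>y\<in>B n. H n j - 1 \<le> u j \<bullet> y) \<and>
             H n j + 5 \<le> H (Suc n) j \<and> H (Suc n) = (H n)(j := H (Suc n) j) \<and>
             polytope (H (Suc n)) \<subseteq> polytope (H n) \<union> B n)"

text \<open>Recursion over the steps, each recorded as a tuple. The condition \<open>P f n r\<close>
  reads \<open>f\<close> only below \<open>n\<close>, with the previous levels stored in step
  \<open>n - 1\<close>, so well-ordered dependent choice applies.\<close>

lemma ex_placement: "\<exists>bi bx li lx H. placement bi bx li lx H"
proof -
  define bi' bx' li' lx' g'
    where "bi' = (\<lambda>r :: nat \<times> 'a \<times> nat \<times> 'a \<times> (nat \<Rightarrow> real). fst r)"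
      and "bx' = (\<lambda>r :: nat \<times> 'a \<times> nat \<times> 'a \<times> (nat \<Rightarrow> real). fst (snd r))"
      and "li' = (\<lambda>r :: nat \<times> 'a \<times> nat \<times> 'a \<times> (nat \<Rightarrow> real). fst (snd (snd r)))"
      and "lx' = (\<lambda>r :: nat \<times> 'a \<times> nat \<times> 'a \<times> (nat \<Rightarrow> real). fst (snd (snd (snd r))))"
      and "g' = (\<lambda>r :: nat \<times> 'a \<times> nat \<times> 'a \<times> (nat \<Rightarrow> real). snd (snd (snd (snd r))))"
  note sel = bi'_def bx'_def li'_def lx'_def g'_def
  define B' L' where "B' r = homothet K lam (bi' r) (bx' r)" and "L' r = homothet K lam (li' r) (lx' r)" for r
  define level where "level f n = (if n = 0 then \<lambda>_. - 1 else g' (f (n - 1)))" for f and n :: nat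
  define P where "P f n r = (let j = n mod m; A = (\<Union>l<n. B' (f l) \<union> L' (f l));
      F = (\<lambda>l. bi' (f l)) ` {..<n} \<union> (\<lambda>l. li' (f l)) ` {..<n}
    in li' r \<notin> F \<and> n \<in> insert (li' r) F \<and> bi' r \<notin> insert (li' r) F \<and>
       L' r \<inter> A = {} \<and> (\<forall>y\<in>L' r. u j \<bullet> y > 2) \<and>
       (\<forall>y\<in>A \<union> L' r. u j \<bullet> y < g' r j - 1) \<and>
       (\<forall>y\<in>B' r. level f n j - 1 \<le> u j \<bullet> y) \<and>
       level f n j + 5 \<le> g' r j \<and> g' r = (level f n)(j := g' r j) \<and>
       polytope (g' r) \<subseteq> polytope (level f n) \<union> B' r)" for f n r
  have "\<exists>f. \<forall>n. P f n (f n)"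
  proof (rule dependent_wellorder_choice)
    fix r and f g :: "nat \<Rightarrow> nat \<times> 'a \<times> nat \<times> 'a \<times> (nat \<Rightarrow> real)" and n
    assume eq: "\<And>l. l < n \<Longrightarrow> f l = g l"
    have "(\<Union>l<n. B' (f l) \<union> L' (f l)) = (\<Union>l<n. B' (g l) \<union> L' (g l))"
      "(\<lambda>l. bi' (f l)) ` {..<n} = (\<lambda>l. bi' (g l)) ` {..<n}"
      "(\<lambda>l. li' (f l)) ` {..<n} = (\<lambda>l. li' (g l)) ` {..<n}"
      using eq by (auto intro!: image_cong)
    moreover have "level f n = level g n" using eq by (auto simp: level_def)
    ultimately show "P f n r = P g n r" unfolding P_def by simp
  next
    fix n f
    define j where "j = n mod m"
    have j: "j < m" using m_pos by (simp add: j_def)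
    define A where "A = (\<Union>l<n. B' (f l) \<union> L' (f l))"
    define F where "F = (\<lambda>l. bi' (f l)) ` {..<n} \<union> (\<lambda>l. li' (f l)) ` {..<n}"
    have "finite F" by (simp add: F_def)
    have "bounded A"
      unfolding A_def B'_def L'_def using bounded_homothet[OF bounded_K] by (intro bounded_UN) auto
    \<comment> \<open>The filler takes index \<open>n\<close> if that is still free, and any fresh
      index otherwise.\<close>
    obtain li where li: "li \<notin> F" "n \<in> insert li F"
      using ex_new_if_finite[OF infinite_UNIV_nat \<open>finite F\<close>] by blast
    have "u j \<noteq> 0" using flat[OF j] by (simp add: flat_direction_def)
    then obtain lx where lx: "homothet K lam li lx \<inter> A = {}" "\<forall>y\<in>homothet K lam li lx. u j \<bullet> y > 2"
      using ex_far_translate[OF bounded_K \<open>bounded A\<close>] by blast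
    have "bounded (A \<union> homothet K lam li lx)" "finite (insert li F)"
      using \<open>bounded A\<close> \<open>finite F\<close> bounded_homothet[OF bounded_K] by auto
    from ex_covering_translate[OF this j, of "level f n"]
    obtain bi bx g where "bi \<notin> insert li F" "level f n j + 5 \<le> g"
      "\<forall>y\<in>A \<union> homothet K lam li lx. u j \<bullet> y < g - 1"
      "\<forall>y\<in>homothet K lam bi bx. level f n j - 1 \<le> u j \<bullet> y"
      "polytope ((level f n)(j := g)) \<subseteq> polytope (level f n) \<union> homothet K lam bi bx"
      by blast
    note new = this
    define r where "r = (bi, bx, li, lx, (level f n)(j := g))"
    have r: "bi' r = bi" "li' r = li" "g' r = (level f n)(j := g)"
      "B' r = homothet K lam bi bx" "L' r = homothet K lam li lx"
      by (simp_all add: r_def sel B'_def L'_def)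
    have "P f n r"
      unfolding P_def Let_def A_def[symmetric] F_def[symmetric] j_def[symmetric] r
      using new li lx by auto
    then show "\<exists>r. P f n r" by blast
  qed
  then obtain f where f: "\<And>n. P f n (f n)" by blast
  show ?thesis
    by (rule exI[of _ "\<lambda>n. bi' (f n)"], rule exI[of _ "\<lambda>n. bx' (f n)"],
        rule exI[of _ "\<lambda>n. li' (f n)"], rule exI[of _ "\<lambda>n. lx' (f n)"], rule exI[of _ "level f"])
      (use f in \<open>simp add: placement_def P_def B'_def L'_def Let_def level_def\<close>)
qed

text \<open>A point of the filler \<open>L k\<close> lies in no other filler and only in bodies
  among the \<open>m\<close> from \<open>B k\<close> on. A point outside all fillers, with first
  body \<open>B k\<close>, lies only in bodies among the \<open>m + 1\<close> from
  \<open>B k\<close> to \<open>B (k + m)\<close>. Opposite directions exclude at least one body in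
  each window.\<close>

lemma translative_covering:
  "translative_covering_mult (\<lambda>i. (\<lambda>y. lam i *\<^sub>R y) ` K) UNIV (m + 1) \<and>
   ((\<forall>j<m. \<exists>j'<m. u j' = - u j) \<longrightarrow> translative_covering_mult (\<lambda>i. (\<lambda>y. lam i *\<^sub>R y) ` K) UNIV m)"
proof -
  obtain bi bx li lx H where pl: "placement bi bx li lx H" using ex_placement by blast
  then have H0: "H 0 j = - 1" for j by (simp add: placement_def)
  define B where "B n = homothet K lam (bi n) (bx n)" for n
  define L where "L n = homothet K lam (li n) (lx n)" for n
  define d where "d n = u (n mod m)" for n
  note step = pl[unfolded placement_def Let_def, folded B_def L_def, folded d_def,
      THEN conjunct2, THEN spec]
  have index: "li n \<notin> bi ` {..<n} \<union> li ` {..<n}"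
      "n \<in> insert (li n) (bi ` {..<n} \<union> li ` {..<n})"
      "bi n \<notin> insert (li n) (bi ` {..<n} \<union> li ` {..<n})"
    and L_disj: "L n \<inter> (\<Union>l<n. B l \<union> L l) = {}"
    and L_high: "\<forall>y\<in>L n. 2 < d n \<bullet> y"
    and old_less: "\<forall>y\<in>(\<Union>l<n. B l \<union> L l) \<union> L n. d n \<bullet> y < H (Suc n) (n mod m) - 1"
    and B_low: "\<forall>y\<in>B n. H n (n mod m) - 1 \<le> d n \<bullet> y"
    and H_incr: "H n (n mod m) + 5 \<le> H (Suc n) (n mod m)"
    and H_upd: "H (Suc n) = (H n)(n mod m := H (Suc n) (n mod m))"
    and cover: "polytope (H (Suc n)) \<subseteq> polytope (H n) \<union> B n" for n
    using step[of n] by - (elim conjE, assumption)+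
  have disj: "y \<notin> B l" "y \<notin> L l" if "y \<in> L n" "l < n" for y l n
    using L_disj[of n] that by auto
  have old: "d n \<bullet> y < H (Suc n) (n mod m) - 1" if "y \<in> B l \<and> l < n \<or> y \<in> L l \<and> l \<le> n" for y l n
  proof -
    have "y \<in> (\<Union>l<n. B l \<union> L l) \<union> L n"
      using that by (cases "l = n") auto
    then show ?thesis using old_less by (rule bspec[rotated])
  qed
  have H_other: "H (Suc n) k = H n k" if "k \<noteq> n mod m" for n k
    using fun_cong[OF H_upd[of n], of k] that by simp
  have "H n k \<le> H (Suc n) k" for n k
    using H_incr[of n] H_other[of k n] by (cases "k = n mod m") auto
  then have H_mono: "H n k \<le> H n' k" if "n \<le> n'" for n n' k
    using that by (rule lift_Suc_mono_le[of "\<lambda>n. H n k"])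
  have H_low: "- 1 \<le> H n k" for n k
    using H_mono[of 0 n k] H0 by simp

  \<comment> \<open>Step \<open>n - m\<close> used the same direction and raised the level past
    everything placed before its body. Its own filler is placed before that body, hence the weak
    inequality for fillers.\<close>
  have apart: "y \<notin> B n" if "y \<in> B l \<and> l + m < n \<or> y \<in> L l \<and> l + m \<le> n" for y l n
  proof
    assume "y \<in> B n"
    define k where "k = n - m"
    have k: "n = k + m" using that by (auto simp: k_def)
    then have same: "k mod m = n mod m" by simp
    have "d k \<bullet> y < H (Suc k) (k mod m) - 1"
      using that k by (intro old[of _ l]) auto
    moreover have "H (Suc k) (k mod m) \<le> H n (k mod m)"
      using k m_pos by (intro H_mono) auto
    moreover have "H n (n mod m) - 1 \<le> d n \<bullet> y" using B_low \<open>y \<in> B n\<close> by blast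
    moreover have "d k = d n" using same by (simp add: d_def)
    ultimately show False using same by simp
  qed
  \<comment> \<open>Starting from -1, one increment of 5 and the margin 1 give height 3. A body in
    the opposite direction stays at height at most 2, and fillers lie above 2, so such a body meets
    neither.\<close>
  have B_high: "d n \<bullet> y \<ge> 3" if "y \<in> B (n + m)" for y n
  proof -
    have "H (Suc n) (n mod m) \<le> H (n + m) (n mod m)"
      using m_pos by (intro H_mono) auto
    moreover have "d (n + m) = d n" by (simp add: d_def)
    moreover have "H (n + m) (n mod m) - 1 \<le> d (n + m) \<bullet> y"
      using B_low[of "n + m"] that by simp
    ultimately show ?thesis using H_incr[of n] H_low[of n "n mod m"] by simp
  qed
  have opposite: "d n \<bullet> y \<le> 2" if "y \<in> B l" "d l = - d n" for y n l
    using bspec[OF B_low that(1)] H_low[of l "l mod m"] that(2) by simp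
  have ex_opposite: "\<exists>l. n < l \<and> l < n + m \<and> d l = - d n" if sym: "\<forall>j<m. \<exists>j'<m. u j' = - u j" for n
  proof -
    define j q where "j = n mod m" and "q = n div m"
    have n: "n = q * m + j" and j: "j < m" using m_pos by (simp_all add: j_def q_def)
    obtain j' where j': "j' < m" "u j' = - u j" using sym j by blast
    have "u j \<noteq> 0" using flat[OF j] by (simp add: flat_direction_def)
    then have "j' \<noteq> j" using j'(2) by (auto simp: eq_neg_iff_add_eq_0 simp flip: scaleR_2)
    \<comment> \<open>The first step after \<open>n\<close> with direction number \<open>j'\<close>:
      in the same round if \<open>j < j'\<close>, else in the next one.\<close>
    define l where "l = (if j < j' then q * m + j' else Suc q * m + j')"
    have "l mod m = j'" using j'(1) by (simp add: l_def del: mult_Suc)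
    then have "d l = - d n" using j'(2) by (simp add: d_def j_def)
    moreover have "n < l" "l < n + m" using n j j'(1) \<open>j' \<noteq> j\<close> by (auto simp: l_def)
    ultimately show ?thesis by blast
  qed

  have count: "finite {n. y \<in> B n} \<and> finite {n. y \<in> L n} \<and> card {n. y \<in> B n} + card {n. y \<in> L n} \<le> m + 1 \<and>
    ((\<forall>j<m. \<exists>j'<m. u j' = - u j) \<longrightarrow> card {n. y \<in> B n} + card {n. y \<in> L n} \<le> m)"
    (is "_ \<and> _ \<and> _ \<and> (?sym \<longrightarrow> _)") for y
  proof (cases "\<exists>k. y \<in> L k")
    case True
    then obtain k where k: "y \<in> L k" by blast
    have SL: "{n. y \<in> L n} = {k}"
      using k disj(2) by (metis (mono_tags, lifting) Collect_cong linorder_neqE_nat singleton_conv)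
    have SB: "{n. y \<in> B n} \<subseteq> {k..<k + m}"
    proof
      fix n assume "n \<in> {n. y \<in> B n}"
      then have "y \<in> B n" by simp
      then have "k \<le> n" "n < k + m"
        using disj(1)[OF k, of n] apart[of y k n] k by (auto intro!: leI)
      then show "n \<in> {k..<k + m}" by simp
    qed
    have "card {n. y \<in> B n} \<le> m" using card_mono[OF _ SB] by simp
    moreover have "card {n. y \<in> B n} < m" if sym: ?sym
    proof -
      obtain l where l: "k < l" "l < k + m" "d l = - d k" using ex_opposite[OF sym] by blast
      have "y \<notin> B l" using opposite[OF _ l(3)] bspec[OF L_high k] by force
      then have "{n. y \<in> B n} \<subset> {k..<k + m}" using SB l by auto
      then show ?thesis using psubset_card_mono[of "{k..<k + m}"] by simp
    qed
    ultimately show ?thesis using SB finite_subset[OF SB] SL by auto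
  next
    case False
    then have SL: "{n. y \<in> L n} = {}" by simp
    show ?thesis
    proof (cases "\<exists>n. y \<in> B n")
      case True
      define k where "k = (LEAST n. y \<in> B n)"
      have k: "y \<in> B k" "\<And>n. y \<in> B n \<Longrightarrow> k \<le> n"
        using LeastI_ex[OF True] Least_le by (auto simp: k_def)
      have SB: "{n. y \<in> B n} \<subseteq> {k..k + m}"
      proof
        fix n assume "n \<in> {n. y \<in> B n}"
        then have "y \<in> B n" by simp
        then have "k \<le> n" "n \<le> k + m"
          using k apart[of y k n] by (auto intro!: leI)
        then show "n \<in> {k..k + m}" by simp
      qed
      have "card {n. y \<in> B n} \<le> m + 1" using card_mono[OF _ SB] by simp
      moreover have "card {n. y \<in> B n} < m + 1" if sym: ?sym
      proof -
        obtain l where l: "k < l" "l < k + m" "d l = - d k" using ex_opposite[OF sym] by blast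
        have "y \<notin> B l \<or> y \<notin> B (k + m)" using opposite[OF _ l(3)] B_high[of y k] by force
        then have "{n. y \<in> B n} \<subset> {k..k + m}" using SB l by auto
        then show ?thesis using psubset_card_mono[of "{k..k + m}"] by simp
      qed
      ultimately show ?thesis using SB finite_subset[OF SB] SL by auto
    qed (simp add: SL)
  qed

  \<comment> \<open>The initial levels are -1, whereas every point has nonnegative height in some
    direction. So the bodies alone cover all later polytopes.\<close>
  have "polytope (H 0) = {}"
  proof -
    obtain c where c: "c > 0" "\<And>x. \<exists>j<m. c * norm x \<le> u j \<bullet> x" using spanning by blast
    have False if "x \<in> polytope (H 0)" for x
    proof -
      obtain j where "j < m" "c * norm x \<le> u j \<bullet> x" using c(2) by blast
      moreover have "c * norm x \<ge> 0" using c(1) by simp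
      ultimately show False using that H0 by (force simp: polytope_def)
    qed
    then show ?thesis by blast
  qed
  then have poly_B: "polytope (H n) \<subseteq> (\<Union>l<n. B l)" for n
  proof (induction n)
    case (Suc n)
    then show ?case using cover[of n] by (auto simp: lessThan_Suc)
  qed simp
  \<comment> \<open>Every round of \<open>m\<close> steps raises each level by at least 5, so the
    polytopes exhaust the space.\<close>
  have H_grows: "- 1 + 5 * real k \<le> H (k * m) j" if "j < m" for k j
  proof (induction k)
    case (Suc k)
    have "H (k * m) j \<le> H (k * m + j) j" by (intro H_mono) simp
    moreover have "H (k * m + j) j + 5 \<le> H (Suc (k * m + j)) j"
      using H_incr[of "k * m + j"] that by simp
    moreover have "H (Suc (k * m + j)) j \<le> H (Suc k * m) j"
      using that by (intro H_mono) simp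
    ultimately show ?case using Suc by simp
  qed (simp add: H0)
  have covered: "\<exists>n. y \<in> B n" for y
  proof -
    obtain k :: nat where k: "(\<Sum>j<m. \<bar>u j \<bullet> y\<bar>) + 1 \<le> real k" using real_arch_simple by blast
    have "u j \<bullet> y \<le> H (k * m) j" if "j < m" for j
    proof -
      have "\<bar>u j \<bullet> y\<bar> \<le> (\<Sum>j<m. \<bar>u j \<bullet> y\<bar>)" using that by (intro member_le_sum) auto
      then show ?thesis using k H_grows[OF that, of k] by simp
    qed
    then have "y \<in> polytope (H (k * m))" by (simp add: polytope_def)
    then show ?thesis using poly_B by blast
  qed

  \<comment> \<open>The indices of bodies and of fillers partition the natural numbers. Hence each
    member of the family gets exactly one translate, and multiplicities are bounded by the two
    counts together.\<close>
  have "inj bi" "inj li" using index by (auto intro!: linorder_injI) (metis UnCI image_eqI lessThan_iff insertCI)+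
  have ne: "bi n \<noteq> li n'" for n n'
  proof (cases "n < n'")
    case True
    then have "bi n \<in> bi ` {..<n'}" by simp
    then show ?thesis using index(1)[of n'] by force
  next
    case False
    then have "li n' \<in> insert (li n) (li ` {..<n})" by (cases "n = n'") auto
    then show ?thesis using index(3)[of n] by force
  qed
  have onto: "i \<in> range bi \<union> range li" for i
    using index(2)[of i] by auto
  define x where "x i = (if i \<in> range bi then bx (inv bi i) else lx (inv li i))" for i
  have x_bi: "x (bi n) = bx n" and x_li: "x (li n) = lx n" for n
    using ne inv_f_f[OF \<open>inj bi\<close>] inv_f_f[OF \<open>inj li\<close>] by (auto simp: x_def) metis
  have members: "{i. p \<in> homothet K lam i (x i)} = bi ` {n. p \<in> B n} \<union> li ` {n. p \<in> L n}" for p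
  proof (intro set_eqI iffI)
    fix i assume "i \<in> {i. p \<in> homothet K lam i (x i)}"
    moreover obtain n where "i = bi n \<or> i = li n" using onto[of i] by blast
    ultimately show "i \<in> bi ` {n. p \<in> B n} \<union> li ` {n. p \<in> L n}"
      by (auto simp: B_def L_def x_bi x_li)
  qed (auto simp: B_def L_def x_bi x_li)
  have fin: "finite {i. p \<in> homothet K lam i (x i)}"
    and card_le: "card {i. p \<in> homothet K lam i (x i)} \<le> card {n. p \<in> B n} + card {n. p \<in> L n}" for p
  proof -
    have f: "finite {n. p \<in> B n}" "finite {n. p \<in> L n}" using count[of p] by blast+
    then show "finite {i. p \<in> homothet K lam i (x i)}" unfolding members by simp
    show "card {i. p \<in> homothet K lam i (x i)} \<le> card {n. p \<in> B n} + card {n. p \<in> L n}"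
      unfolding members by (intro order_trans[OF card_Un_le] add_mono card_image_le f)
  qed
  have UN: "UNIV \<subseteq> (\<Union>i. homothet K lam i (x i))"
  proof
    fix y
    obtain n where "y \<in> B n" using covered by blast
    then have "y \<in> homothet K lam (bi n) (x (bi n))" by (simp add: B_def x_bi)
    then show "y \<in> (\<Union>i. homothet K lam i (x i))" by blast
  qed
  have "translative_covering_mult (\<lambda>i. (\<lambda>y. lam i *\<^sub>R y) ` K) UNIV M"
    if "\<And>p. card {n. p \<in> B n} + card {n. p \<in> L n} \<le> M" for M
    unfolding translative_covering_mult_def homothet_def[symmetric]
    using UN fin le_trans[OF card_le that] by (intro exI[of _ x] conjI allI)
  then show ?thesis using count by simp
qed

end

section \<open>Choice of the directions in the general and in the smooth case\<close>

lemma translative_covering_if_flat_directions: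
  fixes K :: "'a::euclidean_space set"
  assumes "bounded K" "\<And>i. lam i > 0" "\<not> bdd_above (range lam)"
    and U: "finite U" "\<And>u. u \<in> U \<Longrightarrow> flat_direction K u"
      "\<And>v. v \<noteq> 0 \<Longrightarrow> \<exists>u\<in>U. u \<bullet> v > 0"
  shows "translative_covering_mult (\<lambda>i. (\<lambda>y. lam i *\<^sub>R y) ` K) UNIV (card U + 1)"
    and "(\<And>u. u \<in> U \<Longrightarrow> - u \<in> U) \<Longrightarrow>
      translative_covering_mult (\<lambda>i. (\<lambda>y. lam i *\<^sub>R y) ` K) UNIV (card U)"
proof -
  obtain f where "bij_betw f {0..<card U} U" using ex_bij_betw_nat_finite[OF U(1)] by blast
  then have f: "U = f ` {..<card U}" by (simp add: bij_betw_def atLeast0LessThan)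
  obtain c where c: "c > 0" "\<And>x. \<exists>u\<in>U. c * norm x \<le> u \<bullet> x"
    using positively_spanning_norm_bound[OF U(1,3)] by blast
  interpret direction_cycle K lam f "card U"
  proof
    show "card U > 0" using c(2) U(1) by (auto simp: card_gt_0_iff)
    show "flat_direction K (f j)" if "j < card U" for j using U(2) f that by blast
    show "\<exists>c>0. \<forall>x. \<exists>j<card U. c * norm x \<le> f j \<bullet> x"
      using c f by (metis (no_types, lifting) imageE lessThan_iff)
  qed (use assms in auto)
  show "translative_covering_mult (\<lambda>i. (\<lambda>y. lam i *\<^sub>R y) ` K) UNIV (card U + 1)"
    using translative_covering by blast
  assume "\<And>u. u \<in> U \<Longrightarrow> - u \<in> U"
  then have "\<forall>j<card U. \<exists>j'<card U. f j' = - f j"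
    using f by (metis (no_types, lifting) imageE imageI lessThan_iff)
  then show "translative_covering_mult (\<lambda>i. (\<lambda>y. lam i *\<^sub>R y) ` K) UNIV (card U)"
    using translative_covering by blast
qed

text \<open>The linear form \<open>b\<close> attains its minimum and maximum on the compact body;
  the level hyperplanes there support \<open>K\<close>, so smoothness at these points makes
  \<open>b\<close> and \<open>- b\<close> flat.\<close>

lemma flat_direction_axis:
  fixes K :: "'a::euclidean_space set"
  assumes K: "convex_body K" and "b \<noteq> 0"
    and smooth: "\<And>c p. p \<in> K \<Longrightarrow> supporting_hyperplane K {y. b \<bullet> y = c} \<Longrightarrow> b \<bullet> p = c \<Longrightarrow> smooth_at K p"
  shows "flat_direction K b" "flat_direction K (- b)"
proof -
  have "compact K" "K \<noteq> {}" using K interior_subset by (auto simp: convex_body_def)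
  moreover have "continuous_on K (\<lambda>y. b \<bullet> y)" by (intro continuous_intros)
  ultimately obtain p q where p: "p \<in> K" "\<forall>y\<in>K. b \<bullet> p \<le> b \<bullet> y" and q: "q \<in> K" "\<forall>y\<in>K. b \<bullet> y \<le> b \<bullet> q"
    using continuous_attains_inf[of K "\<lambda>y. b \<bullet> y"] continuous_attains_sup[of K "\<lambda>y. b \<bullet> y"] by metis
  have "supporting_hyperplane K {y. b \<bullet> y = b \<bullet> p}"
    unfolding supporting_hyperplane_def
    using p \<open>b \<noteq> 0\<close> by (intro exI[of _ "- b"] exI[of _ "- (b \<bullet> p)"]) auto
  then have "smooth_at K p" using smooth p(1) by blast
  then show "flat_direction K b" using flat_direction_if_smooth[OF K _ p(1) \<open>b \<noteq> 0\<close> p(2)] by blast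
  have "supporting_hyperplane K {y. b \<bullet> y = b \<bullet> q}"
    unfolding supporting_hyperplane_def
    using q \<open>b \<noteq> 0\<close> by (intro exI[of _ b] exI[of _ "b \<bullet> q"]) auto
  then have "smooth_at K q" using smooth q(1) by blast
  then show "flat_direction K (- b)" using flat_direction_if_smooth[OF K _ q(1), of "- b"] \<open>b \<noteq> 0\<close> q(2) by simp
qed

theorem mainTheorem7:
  fixes K :: "'a::euclidean_space set" and lam :: "nat \<Rightarrow> real"
  assumes "convex_body K"
    and "\<And>i. lam i > 0"
    and "\<not> bdd_above (range lam)"
  shows "translative_covering_mult (\<lambda>i. (\<lambda>y. lam i *\<^sub>R y) ` K) UNIV (4 * DIM('a))
     \<and> ((\<forall>b\<in>Basis. \<forall>c. \<forall>p\<in>K.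
            supporting_hyperplane K {y. b \<bullet> y = c} \<and> b \<bullet> p = c \<longrightarrow> smooth_at K p)
         \<longrightarrow> translative_covering_mult (\<lambda>i. (\<lambda>y. lam i *\<^sub>R y) ` K) UNIV (2 * DIM('a)))"
proof (intro conjI impI)
  have "bounded K" using assms(1) by (simp add: convex_body_def compact_imp_bounded)
  note covering = translative_covering_if_flat_directions[OF this assms(2,3)]
  have "\<exists>u\<in>{u. flat_direction K u}. u \<bullet> v > 0" if "v \<noteq> 0" for v
    using ex_flat_direction[OF assms(1) that] by blast
  from few_positively_spanning[of "{u. flat_direction K u}", OF this]
  obtain U where U: "finite U" "U \<subseteq> {u. flat_direction K u}" "card U \<le> 2 * DIM('a) + 1"
    "\<forall>v. v \<noteq> 0 \<longrightarrow> (\<exists>u\<in>U. u \<bullet> v > 0)"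
    by blast
  have "translative_covering_mult (\<lambda>i. (\<lambda>y. lam i *\<^sub>R y) ` K) UNIV (card U + 1)"
    using U by (intro covering(1)) auto
  \<comment> \<open>Here \<open>2 * DIM('a) + 2 \<le> 4 * DIM('a)\<close> because the dimension is
    at least 1.\<close>
  moreover have "card U + 1 \<le> 4 * DIM('a)" using U(3) DIM_positive[where 'a='a] by linarith
  ultimately show "translative_covering_mult (\<lambda>i. (\<lambda>y. lam i *\<^sub>R y) ` K) UNIV (4 * DIM('a))"
    by (rule translative_covering_mult_mono)

  assume smooth: "\<forall>b\<in>Basis. \<forall>c. \<forall>p\<in>K.
            supporting_hyperplane K {y. b \<bullet> y = c} \<and> b \<bullet> p = c \<longrightarrow> smooth_at K p"
  \<comment> \<open>The signed axis vectors are closed under negation, which saves the extra 1 in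
    the multiplicity.\<close>
  define V :: "'a set" where "V = Basis \<union> uminus ` Basis"
  have "flat_direction K u" if u: "u \<in> V" for u
  proof -
    obtain b where b: "b \<in> Basis" "u = b \<or> u = - b" using u unfolding V_def by blast
    have "smooth_at K p" if "p \<in> K" "supporting_hyperplane K {y. b \<bullet> y = c}" "b \<bullet> p = c" for c p
      using smooth b(1) that by blast
    then show ?thesis
      using flat_direction_axis[OF assms(1) nonzero_Basis[OF b(1)]] b(2) by blast
  qed
  moreover have "\<exists>u\<in>V. u \<bullet> v > 0" if v: "v \<noteq> 0" for v
  proof -
    obtain b where b: "b \<in> Basis" "v \<bullet> b \<noteq> 0" using v euclidean_all_zero_iff[of v] by blast
    then have "b \<bullet> v > 0 \<or> (- b) \<bullet> v > 0" by (simp add: inner_commute linorder_neq_iff disj_commute)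
    then show ?thesis using b(1) unfolding V_def by blast
  qed
  ultimately have "translative_covering_mult (\<lambda>i. (\<lambda>y. lam i *\<^sub>R y) ` K) UNIV (card V)"
    by (intro covering(2)) (auto simp: V_def)
  moreover have "card V \<le> 2 * DIM('a)"
    unfolding V_def using card_Un_le[of Basis "uminus ` (Basis :: 'a set)"]
      card_image_le[OF finite_Basis, of "uminus :: 'a \<Rightarrow> 'a"] by linarith
  ultimately show "translative_covering_mult (\<lambda>i. (\<lambda>y. lam i *\<^sub>R y) ` K) UNIV (2 * DIM('a))"
    by (rule translative_covering_mult_mono)
qed

end
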